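(* Let $\mathbb{R}^n$ be equipped with the Euclidean norm $\|\cdot\|=\|\cdot\|_2$, let $f:\mathbb{R}^n\to\mathbb{R}$ be a proper function, let $\overline{x}\in\mathbb{R}^n$, and let $f(\overline{x})$ be finite. Assume that $f$ is radially epidifferentiable at $\overline{x}$. Then for every $\varepsilon>0$ and every $h\in\mathbb{R}^n\setminus\{0\}$ with $\|h\|=1$ there exists a weak subgradient $(v,c)\in\partial^w f(\overline{x})$ such that $$v=(c+f^r(\overline{x};h)-\varepsilon)\,h,$$ and hence $$f^r(\overline{x};h)=\langle v,h\rangle-c+\varepsilon.$$
   Context: A pair $(v,c)\in\mathbb{R}^n\times\mathbb{R}_+$ (so $c\ge 0$) is a weak subgradient of $f$ at $\overline{x}$ if $f(x)\ge f(\overline{x})+\langle v,x-\overline{x}\rangle-c\|x-\overline{x}\|$ for all $x\in\mathbb{R}^n$; the set of all weak subgradients of $f$ at $\overline{x}$ is the weak subdifferential $\partial^w f(\overline{x})$. For a nonempty subset $A$ of a real normed space and $a\in A$, the closed radial cone is $R(A;a)=\mathrm{cl}(\mathrm{cone}(A-a))$, i.e. the set of all $w$ for which there are $\lambda_n>0$ and $a_n\in A$ with $\lim_{n\to\infty}\lambda_n(a_n-a)=w$. The epigraph of $f$ is $\mathrm{epi}\,f=\{(x,y)\in\mathbb{R}^n\times\mathbb{R}: f(x)\le y\}$. The radial epiderivative $f^r(\overline{x};\cdot)$ is the function defined by $\mathrm{epi}\,f^r(\overline{x};\cdot)=R(\mathrm{epi}\,f;(\overline{x},f(\overline{x})))$;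 thus $f^r(\overline{x};h)=\inf\{y\in\mathbb{R}:(h,y)\in R(\mathrm{epi}\,f;(\overline{x},f(\overline{x})))\}$. The function $f$ is called radially epidifferentiable at $\overline{x}$ if $f^r(\overline{x};h)$ exists and is finite for every $h\in\mathbb{R}^n$. *)

theory Defs
  imports "HOL-Analysis.Analysis"
begin

text \<open>
  Functions take values in the extended reals, as in convex analysis, so that properness and
  finiteness at a point are genuine conditions. A real-valued function \<open>g\<close> is covered as
  \<open>\<lambda>x. ereal (g x)\<close>.
\<close>

definition proper_fun :: "('a \<Rightarrow> ereal) \<Rightarrow> bool" where
  "proper_fun f \<longleftrightarrow> (\<forall>x. f x \<noteq> -\<infinity>) \<and> (\<exists>x. f x \<noteq> \<infinity>)"

definition epi :: "('a \<Rightarrow> ereal) \<Rightarrow> ('a \<times> real) set" where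
  "epi f = {(x, y). f x \<le> ereal y}"

definition weak_subdiff :: "('a::real_inner \<Rightarrow> ereal) \<Rightarrow> 'a \<Rightarrow> ('a \<times> real) set" where
  "weak_subdiff f xbar =
     {(v, c). 0 \<le> c \<and> (\<forall>x. f xbar + ereal (v \<bullet> (x - xbar) - c * norm (x - xbar)) \<le> f x)}"

definition radial_cone :: "'a::real_normed_vector set \<Rightarrow> 'a \<Rightarrow> 'a set" where
  "radial_cone A a = closure (cone hull ((\<lambda>z. z - a) ` A))"

text \<open>The base point on the graph of \<open>f\<close> is meaningful only if \<open>f xbar\<close> is finite.\<close>

definition radial_epideriv :: "('a::real_normed_vector \<Rightarrow> ereal) \<Rightarrow> 'a \<Rightarrow> 'a \<Rightarrow> ereal" where
  "radial_epideriv f xbar h =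
     Inf {ereal y | y. (h, y) \<in> radial_cone (epi f) (xbar, real_of_ereal (f xbar))}"

definition radially_epidifferentiable :: "('a::real_normed_vector \<Rightarrow> ereal) \<Rightarrow> 'a \<Rightarrow> bool" where
  "radially_epidifferentiable f xbar \<longleftrightarrow> (\<forall>h. \<bar>radial_epideriv f xbar h\<bar> \<noteq> \<infinity>)"

lemma radial_cone_sequential:
  assumes "a \<in> A"
  shows "w \<in> radial_cone A a \<longleftrightarrow>
    (\<exists>l z. (\<forall>n. l n > 0 \<and> z n \<in> A) \<and> (\<lambda>n::nat. l n *\<^sub>R (z n - a)) \<longlonglongrightarrow> w)"
    (is "?L \<longleftrightarrow> ?R")
proof
  assume ?L
  then obtain s where s: "\<And>n. s n \<in> cone hull ((\<lambda>z. z - a) ` A)" and lim: "s \<longlonglongrightarrow> w"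
    unfolding radial_cone_def closure_sequential by blast
  have "\<exists>l z. l > 0 \<and> z \<in> A \<and> s n = l *\<^sub>R (z - a)" for n
  proof -
    obtain l z where lz: "0 \<le> l" "z \<in> A" "s n = l *\<^sub>R (z - a)"
      using s[of n] unfolding cone_hull_expl by blast
    show ?thesis
    proof (cases "l = 0")
      case True
      then have "s n = 1 *\<^sub>R (a - a)" using lz by simp
      then show ?thesis using assms zero_less_one by blast
    next
      case False
      then have "0 < l" using lz(1) by simp
      then show ?thesis using lz by blast
    qed
  qed
  then obtain l z where lz: "\<And>n. l n > 0 \<and> z n \<in> A \<and> s n = l n *\<^sub>R (z n - a)" by metis
  then have s_eq: "s = (\<lambda>n. l n *\<^sub>R (z n - a))" by blast
  have "(\<lambda>n. l n *\<^sub>R (z n - a)) \<longlonglongrightarrow> w" using lim unfolding s_eq .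
  with lz show ?R by (intro exI[of _ l] exI[of _ z]) blast
next
  assume ?R
  then obtain l z where lz: "\<And>n. l n > 0 \<and> z n \<in> A"
    and lim: "(\<lambda>n::nat. l n *\<^sub>R (z n - a)) \<longlonglongrightarrow> w" by blast
  have "l n *\<^sub>R (z n - a) \<in> cone hull ((\<lambda>z. z - a) ` A)" for n
    using lz[of n] unfolding cone_hull_expl by (auto intro: less_imp_le)
  then show ?L
    unfolding radial_cone_def closure_sequential using lim
    by (intro exI[of _ "\<lambda>n. l n *\<^sub>R (z n - a)"]) simp
qed

lemma radial_cone_epi_upward:
  assumes fin: "\<bar>f xbar\<bar> \<noteq> \<infinity>" and "0 \<le> s"
    and mem: "(h, y) \<in> radial_cone (epi f) (xbar, real_of_ereal (f xbar))"
  shows "(h, y + s) \<in> radial_cone (epi f) (xbar, real_of_ereal (f xbar))"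
proof -
  let ?a = "(xbar, real_of_ereal (f xbar))"
  have a: "?a \<in> epi f" using fin by (simp add: epi_def ereal_real)
  obtain l z where lz: "\<And>n. l n > 0 \<and> z n \<in> epi f"
    and lim: "(\<lambda>n::nat. l n *\<^sub>R (z n - ?a)) \<longlonglongrightarrow> (h, y)"
    using mem unfolding radial_cone_sequential[OF a] by blast
  have mem_epi: "z n + (0, s / l n) \<in> epi f" for n
  proof -
    obtain p q where pq: "z n = (p, q)" by fastforce
    then have "f p \<le> ereal q" using lz[of n] by (simp add: epi_def)
    also have "\<dots> \<le> ereal (q + s / l n)" using lz[of n] \<open>0 \<le> s\<close> by simp
    finally show ?thesis using pq by (simp add: epi_def)
  qed
  have "l n *\<^sub>R (z n + (0, s / l n) - ?a) = l n *\<^sub>R (z n - ?a) + (0, s)" for n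
    using lz[of n] by (cases "z n") (auto simp: field_simps)
  moreover have "(\<lambda>n. l n *\<^sub>R (z n - ?a) + (0, s)) \<longlonglongrightarrow> (h, y) + (0, s)"
    by (intro tendsto_intros lim)
  ultimately have "(\<lambda>n. l n *\<^sub>R (z n + (0, s / l n) - ?a)) \<longlonglongrightarrow> (h, y + s)" by simp
  with mem_epi lz show ?thesis
    unfolding radial_cone_sequential[OF a]
    by (intro exI[of _ l] exI[of _ "\<lambda>n. z n + (0, s / l n)"]) blast
qed

theorem epi_radial_epideriv:
  assumes fin: "\<bar>f xbar\<bar> \<noteq> \<infinity>"
  shows "epi (radial_epideriv f xbar) = radial_cone (epi f) (xbar, real_of_ereal (f xbar))"
    (is "_ = ?R")
proof (intro set_eqI iffI)
  fix w assume "w \<in> ?R"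
  then show "w \<in> epi (radial_epideriv f xbar)"
    unfolding epi_def radial_epideriv_def by (cases w) (auto intro!: Inf_lower)
next
  fix w assume w: "w \<in> epi (radial_epideriv f xbar)"
  obtain h y where hy: "w = (h, y)" by fastforce
  have le: "radial_epideriv f xbar h \<le> ereal y" using w hy by (simp add: epi_def)
  have R: "(h, y + 1 / Suc n) \<in> ?R" for n
  proof -
    have "radial_epideriv f xbar h < ereal (y + 1 / Suc n)"
      using le by (rule le_less_trans) simp
    then obtain y' where y': "(h, y') \<in> ?R" "y' < y + 1 / Suc n"
      unfolding radial_epideriv_def Inf_less_iff by auto
    show ?thesis
      using radial_cone_epi_upward[OF fin _ y'(1), of "y + 1 / Suc n - y'"] y'(2) by simp
  qed
  have "(\<lambda>n. y + 1 / real (Suc n)) \<longlonglongrightarrow> y"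
    using LIMSEQ_inverse_real_of_nat_add[of y] unfolding inverse_eq_divide .
  then have lim: "(\<lambda>n. (h, y + 1 / real (Suc n))) \<longlonglongrightarrow> (h, y)"
    by (intro tendsto_Pair tendsto_const)
  have "closed ?R" unfolding radial_cone_def by (rule closed_closure)
  from closed_sequentially[OF this R lim] show "w \<in> ?R" unfolding hy .
qed

end

theory Submission
  imports Defs
begin

text \<open>
  The radial epiderivative \<open>g\<close> is lower semicontinuous, positively homogeneous and nowhere
  \<open>-\<infinity>\<close>, and it bounds \<open>f - f xbar\<close> from below, so it suffices to find \<open>c\<close> with
  \<open>c * (h \<bullet> u - 1) + t * (h \<bullet> u) \<le> g u\<close> on the unit sphere, where \<open>t = g h - \<epsilon>\<close>. If no \<open>c = n\<close>
  works, the violating points accumulate at some \<open>u\<close> of the sphere. For \<open>u \<noteq> h\<close> we have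
  \<open>h \<bullet> u < 1\<close>, and closedness of the epigraph forces \<open>g u = -\<infinity>\<close>; for \<open>u = h\<close> it forces
  \<open>g h \<le> t\<close>. Both are impossible.
\<close>

text \<open>Lower semicontinuity with bounds that may move along the sequence; it serves below once
  with convergent bounds and once with constant ones.\<close>

lemma closed_epi_limit_le:
  fixes g :: "'a::topological_space \<Rightarrow> ereal"
  assumes "closed (epi g)" "u \<longlonglongrightarrow> a" "y \<longlonglongrightarrow> b"
    and le: "\<forall>\<^sub>F n in sequentially. g (u n) \<le> ereal (y n)"
  shows "g a \<le> ereal b"
proof -
  have "(\<lambda>n. (u n, y n)) \<longlonglongrightarrow> (a, b)"
    using assms(2,3) by (rule tendsto_Pair)
  moreover have "\<forall>\<^sub>F n in sequentially. (u n, y n) \<in> epi g"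
    using le by (simp add: epi_def)
  ultimately have "(a, b) \<in> epi g"
    by (intro Lim_in_closed_set[OF assms(1)]) auto
  then show ?thesis by (simp add: epi_def)
qed

text \<open>The equality case of Cauchy-Schwarz: unit vectors with inner product 1 coincide.\<close>

lemma inner_less_one_if_norm_one:
  fixes h u :: "'a::real_inner"
  assumes "norm h = 1" "norm u = 1" "u \<noteq> h"
  shows "h \<bullet> u < 1"
proof -
  have "h \<bullet> u \<noteq> 1"
    using assms norm_cauchy_schwarz_eq[of h u] by auto
  then show ?thesis
    using norm_cauchy_schwarz[of h u] assms by simp
qed

text \<open>With \<open>v = (c + t) *\<^sub>R h\<close> the lower bound is
  \<open>v \<bullet> u - c\<close>, so this is the weak subgradient inequality on unit directions.
  Its term \<open>c * (h \<bullet> u - 1)\<close> is a penalty that vanishes only at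
  \<open>u = h\<close>.\<close>

lemma sphere_lower_bound:
  fixes g :: "'a::euclidean_space \<Rightarrow> ereal"
  assumes cl: "closed (epi g)"
    and not_minf: "\<And>u. g u \<noteq> -\<infinity>"
    and h: "norm h = 1"
    and t: "ereal t < g h"
  obtains c where "0 \<le> c"
    "\<And>u. norm u = 1 \<Longrightarrow> ereal (c * (h \<bullet> u - 1) + t * (h \<bullet> u)) \<le> g u"
proof (rule ccontr)
  assume no_bound: "\<not> thesis"
  have "\<exists>u. norm u = 1 \<and> g u < ereal (real n * (h \<bullet> u - 1) + t * (h \<bullet> u))" for n
  proof (rule ccontr)
    assume "\<not> ?thesis"
    then have "ereal (real n * (h \<bullet> u - 1) + t * (h \<bullet> u)) \<le> g u" if "norm u = 1" for u
      using that not_less by blast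
    then have thesis by (rule that[OF of_nat_0_le_iff])
    with no_bound show False by (rule notE)
  qed
  then obtain w where w: "\<And>n. norm (w n) = 1"
      "\<And>n. g (w n) < ereal (real n * (h \<bullet> w n - 1) + t * (h \<bullet> w n))"
    by metis
  \<comment> \<open>Compactness of the sphere: the violating points \<open>w n\<close>, one for each
    candidate \<open>c = n\<close>, have a convergent subsequence.\<close>
  obtain u s where s: "strict_mono s" and lim: "(w \<circ> s) \<longlonglongrightarrow> u" and u: "u \<in> sphere 0 1"
    using compact_sphere[of "0::'a" 1, unfolded compact_def, rule_format, of w] w(1) by auto
  have lim_inner: "(\<lambda>n. h \<bullet> w (s n)) \<longlonglongrightarrow> h \<bullet> u"
    using tendsto_inner[OF tendsto_const lim, of h] by (simp add: o_def)
  have real_s: "filterlim (\<lambda>n. real (s n)) at_top sequentially"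
    using filterlim_compose[OF filterlim_real_sequentially filterlim_subseq[OF s]] .
  show False
  proof (cases "u = h")
    case True
    have "g (w n) \<le> ereal (t * (h \<bullet> w n))" for n
    proof -
      have "h \<bullet> w n \<le> 1"
        using norm_cauchy_schwarz[of h "w n"] h w(1)[of n] by simp
      then have "real n * (h \<bullet> w n - 1) \<le> 0"
        by (simp add: mult_nonneg_nonpos)
      then have "ereal (real n * (h \<bullet> w n - 1) + t * (h \<bullet> w n)) \<le> ereal (t * (h \<bullet> w n))"
        by simp
      then show ?thesis using w(2)[of n] by (meson less_imp_le order_trans)
    qed
    moreover have "(\<lambda>n. t * (h \<bullet> w (s n))) \<longlonglongrightarrow> t * (h \<bullet> u)"
      by (intro tendsto_intros lim_inner)
    ultimately have "g u \<le> ereal (t * (h \<bullet> u))"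
      using closed_epi_limit_le[OF cl lim] by simp
    then show False
      using t True h by (simp add: norm_eq_1)
  next
    case False
    then have "h \<bullet> u - 1 < 0"
      using inner_less_one_if_norm_one[OF h] u by simp
    \<comment> \<open>Away from \<open>h\<close> the penalty factor has a negative limit while its
      weight \<open>s n\<close> grows without bound.\<close>
    then have "filterlim (\<lambda>n. (h \<bullet> w (s n) - 1) * real (s n)) at_bot sequentially"
      by (rule filterlim_tendsto_neg_mult_at_bot
          [OF tendsto_diff[OF lim_inner tendsto_const] _ real_s])
    moreover have "(\<lambda>n. t * (h \<bullet> w (s n))) \<longlonglongrightarrow> t * (h \<bullet> u)"
      by (intro tendsto_intros lim_inner)
    ultimately have bot:
      "filterlim (\<lambda>n. t * (h \<bullet> w (s n)) + (h \<bullet> w (s n) - 1) * real (s n)) at_bot sequentially"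
      by (simp add: filterlim_tendsto_add_at_bot_iff)
    have "g u \<le> ereal K" for K
    proof (rule closed_epi_limit_le[OF cl lim tendsto_const])
      have "\<forall>\<^sub>F n in sequentially. t * (h \<bullet> w (s n)) + (h \<bullet> w (s n) - 1) * real (s n) \<le> K"
        using bot unfolding filterlim_at_bot by blast
      then show "\<forall>\<^sub>F n in sequentially. g ((w \<circ> s) n) \<le> ereal K"
      proof eventually_elim
        case (elim n)
        then have "ereal (real (s n) * (h \<bullet> w (s n) - 1) + t * (h \<bullet> w (s n))) \<le> ereal K"
          by (simp add: algebra_simps)
        with w(2)[of "s n"] show ?case unfolding o_def by (meson less_imp_le order_trans)
      qed
    qed
    then have "g u = -\<infinity>" by (rule ereal_bot)
    with not_minf show False by blast
  qed
qed

text \<open>The scaled difference of epigraph points lies in the cone even before closure. A real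
  \<open>y\<close> above \<open>f x\<close> replaces \<open>f x\<close>, which may be
  infinite.\<close>

lemma radial_epideriv_le_quotient:
  assumes fin: "\<bar>f xbar\<bar> \<noteq> \<infinity>" and y: "f x \<le> ereal y" and "0 < d"
  shows "radial_epideriv f xbar ((x - xbar) /\<^sub>R d) \<le> ereal ((y - real_of_ereal (f xbar)) / d)"
proof -
  let ?a = "(xbar, real_of_ereal (f xbar))"
  have "(x, y) \<in> epi f" using y by (simp add: epi_def)
  then have "inverse d *\<^sub>R ((x, y) - ?a) \<in> cone hull ((\<lambda>z. z - ?a) ` epi f)"
    using \<open>0 < d\<close> by (intro mem_cone[OF cone_cone_hull] hull_inc imageI) simp_all
  then have "inverse d *\<^sub>R ((x, y) - ?a) \<in> radial_cone (epi f) ?a"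
    unfolding radial_cone_def using closure_subset by blast
  then show ?thesis
    unfolding epi_radial_epideriv[of f xbar, OF fin, symmetric] by (simp add: epi_def field_simps)
qed

theorem theorem9:
  fixes f :: "real ^ 'n \<Rightarrow> ereal" and xbar :: "real ^ 'n"
  assumes "proper_fun f"
    and "\<bar>f xbar\<bar> \<noteq> \<infinity>"
    and "radially_epidifferentiable f xbar"
  shows "\<forall>\<epsilon>>0. \<forall>h. h \<noteq> 0 \<and> norm h = 1 \<longrightarrow>
    (\<exists>v c. (v, c) \<in> weak_subdiff f xbar \<and>
       v = (c + real_of_ereal (radial_epideriv f xbar h) - \<epsilon>) *\<^sub>R h \<and>
       radial_epideriv f xbar h = ereal (v \<bullet> h - c + \<epsilon>))"
proof (intro allI impI)
  fix \<epsilon> :: real and h :: "real ^ 'n"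
  assume \<epsilon>: "0 < \<epsilon>" and "h \<noteq> 0 \<and> norm h = 1"
  then have h: "norm h = 1" by simp
  let ?g = "radial_epideriv f xbar"
  define r where "r = real_of_ereal (?g h)"
  define b where "b = real_of_ereal (f xbar)"
  have g_fin: "\<bar>?g u\<bar> \<noteq> \<infinity>" for u
    using assms(3) by (simp add: radially_epidifferentiable_def)
  have gh: "?g h = ereal r" using g_fin[of h] by (simp add: r_def ereal_real)
  have fb: "f xbar = ereal b" using assms(2) by (simp add: b_def ereal_real)
  have "closed (epi ?g)"
    unfolding epi_radial_epideriv[of f xbar, OF assms(2)] by (simp add: radial_cone_def)
  moreover have "?g u \<noteq> -\<infinity>" for u using g_fin[of u] by auto
  \<comment> \<open>Here \<open>\<epsilon> > 0\<close> supplies the strict gap at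
    \<open>h\<close>.\<close>
  moreover have "ereal (r - \<epsilon>) < ?g h" using gh \<epsilon> by simp
  ultimately obtain c where c: "0 \<le> c"
    "\<And>u. norm u = 1 \<Longrightarrow> ereal (c * (h \<bullet> u - 1) + (r - \<epsilon>) * (h \<bullet> u)) \<le> ?g u"
    using sphere_lower_bound[of ?g h "r - \<epsilon>"] h by blast
  define v where "v = (c + r - \<epsilon>) *\<^sub>R h"
  have "f xbar + ereal (v \<bullet> (x - xbar) - c * norm (x - xbar)) \<le> f x" for x
  proof (cases "x = xbar")
    case True
    then show ?thesis by simp
  next
    case False
    define d where "d = norm (x - xbar)"
    define u where "u = (x - xbar) /\<^sub>R d"
    have d: "0 < d" using False by (simp add: d_def)
    have u: "norm u = 1" "x - xbar = d *\<^sub>R u" using d by (auto simp: u_def d_def)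
    show ?thesis
    \<comment> \<open>Testing against all real upper bounds \<open>y\<close> of \<open>f x\<close>
      also covers \<open>f x = \<infinity>\<close>, where there are none.\<close>
    proof (rule ereal_le_real)
      fix y assume y: "f x \<le> ereal y"
      have "ereal (c * (h \<bullet> u - 1) + (r - \<epsilon>) * (h \<bullet> u)) \<le> ereal ((y - b) / d)"
        using c(2)[OF u(1)] radial_epideriv_le_quotient[of f xbar x y d, OF assms(2) y d]
        unfolding u_def b_def by (rule order_trans)
      then have "(c * (h \<bullet> u - 1) + (r - \<epsilon>) * (h \<bullet> u)) * d \<le> y - b"
        using d by (simp add: pos_le_divide_eq)
      \<comment> \<open>Scaling by \<open>d\<close> carries the bound from the unit direction
        \<open>u\<close> back to \<open>x - xbar\<close>.\<close>
      moreover have "v \<bullet> (x - xbar) - c * d = (c * (h \<bullet> u - 1) + (r - \<epsilon>) * (h \<bullet> u)) * d"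
        unfolding u(2) v_def by (simp add: algebra_simps)
      ultimately show "f xbar + ereal (v \<bullet> (x - xbar) - c * norm (x - xbar)) \<le> ereal y"
        unfolding fb d_def[symmetric] by simp
    qed
  qed
  then have "(v, c) \<in> weak_subdiff f xbar"
    using c(1) by (simp add: weak_subdiff_def)
  moreover have "?g h = ereal (v \<bullet> h - c + \<epsilon>)"
    using h by (simp add: gh v_def norm_eq_1)
  ultimately show "\<exists>v c. (v, c) \<in> weak_subdiff f xbar \<and>
       v = (c + real_of_ereal (?g h) - \<epsilon>) *\<^sub>R h \<and> ?g h = ereal (v \<bullet> h - c + \<epsilon>)"
    unfolding r_def[symmetric] using v_def by blast
qed

end
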